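(* Let $n \ge 2$, let $K$ be a compact convex subset of $\mathbb{R}^n$ and let $T$ be an $n$-dimensional simplex in $\mathbb{R}^n$ such that, for every unit vector $u$, the projection $T_u$ contains a translate of $K_u$. Then $$V_n(K) \le \tfrac{n}{n-1}\, V_n(T).$$
   Context: For a set $S \subseteq \mathbb{R}^n$ and a unit vector $u$, $S_u$ denotes the orthogonal projection of $S$ onto $u^\perp$. "$A$ contains a translate of $B$" means $B+w\subseteq A$ for some vector $w$. $V_n$ is $n$-dimensional volume. *)

theory Defs
  imports "HOL-Analysis.Analysis"
begin

text \<open>Orthogonal projection of a set S onto the hyperplane through the origin orthogonal to u
  (u is assumed to be a unit vector where this is used).\<close>
definition proj_perp :: "'a::euclidean_space \<Rightarrow> 'a set \<Rightarrow> 'a set" where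
  "proj_perp u S = (\<lambda>x. x - (x \<bullet> u) *\<^sub>R u) ` S"

end

theory Submission
  imports Defs
begin

text \<open>Let \<open>m e\<close> be the minimum over \<open>K\<close> of the barycentric coordinate \<open>bary e\<close> belonging to the vertex
  \<open>e\<close> of \<open>T\<close>, and let \<open>t = - (\<Sum>e. m e)\<close>. Only the projections along the edges of \<open>T\<close> are needed:
  the one along \<open>c - d\<close> says exactly that \<open>bary c + bary d \<ge> m c + m d + t\<close> on \<open>K\<close>.
  If \<open>t \<le> 0\<close> then a translate of \<open>T\<close> contains \<open>K\<close>. Otherwise \<open>q = 1 - (n - 1) t\<close> lies in \<open>[0, 1]\<close>, and
  \<open>K\<close> is covered by the homothet \<open>bary e \<ge> m e + t / 2\<close> of \<open>T\<close> of ratio \<open>r = (1 + q) / 2\<close>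
  together with one frustum \<open>m c \<le> bary c \<le> m c + t / 2\<close> on each of its \<open>n + 1\<close> facets.
  A frustum is the difference of two homothets, of ratios \<open>r\<close> and \<open>q\<close>, of the simplex obtained from \<open>T\<close> by
  replacing \<open>c\<close> with the point where \<open>bary c = - 1 / (n - 1)\<close> and the other coordinates are equal;
  that simplex has volume \<open>V(T) / (n - 1)\<close>. Convexity of \<open>x ^ n\<close> then gives
  \<open>r ^ n + (n + 1) (r ^ n - q ^ n) / (n - 1) \<le> n / (n - 1)\<close>.\<close>

section \<open>Volume of a simplex with one vertex replaced\<close>

typedef (overloaded) 'a basis_index = "Basis :: 'a::euclidean_space set"
  using nonempty_Basis by blast

lemma range_Rep_basis_index: "range Rep_basis_index = (Basis :: 'a::euclidean_space set)"
  using type_definition.Rep_range[OF type_definition_basis_index] by simp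

lemma inj_Rep_basis_index: "inj Rep_basis_index"
  by (simp add: inj_def Rep_basis_index_inject)

text \<open>The change of variables results for \<^typ>\<open>real ^ 'n\<close> ask for a well-ordered index type,
  hence the arbitrary enumeration of the basis.\<close>
instantiation basis_index :: (euclidean_space) "{finite, wellorder}"
begin

definition less_eq_basis_index :: "'a basis_index \<Rightarrow> 'a basis_index \<Rightarrow> bool" where
  "i \<le> j \<longleftrightarrow> to_nat_on Basis (Rep_basis_index i) \<le> to_nat_on Basis (Rep_basis_index j)"

definition less_basis_index :: "'a basis_index \<Rightarrow> 'a basis_index \<Rightarrow> bool" where
  "i < j \<longleftrightarrow> to_nat_on Basis (Rep_basis_index i) < to_nat_on Basis (Rep_basis_index j)"

instance
proof
  fix i j :: "'a basis_index"
  show "i = j" if "i \<le> j" "j \<le> i"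
  proof -
    have "to_nat_on Basis (Rep_basis_index i) = to_nat_on Basis (Rep_basis_index j)"
      using that by (simp add: less_eq_basis_index_def)
    then have "Rep_basis_index i = Rep_basis_index j"
      using to_nat_on_inj[of "Basis :: 'a set"] Rep_basis_index
      by (metis countable_finite finite_Basis)
    then show ?thesis by (simp add: Rep_basis_index_inject)
  qed
next
  fix P :: "'a basis_index \<Rightarrow> bool" and k
  assume step: "\<And>i. (\<And>j. j < i \<Longrightarrow> P j) \<Longrightarrow> P i"
  show "P k"
  proof (induction k rule: measure_induct_rule[of "\<lambda>i. to_nat_on Basis (Rep_basis_index i)"])
    case (less k)
    show ?case by (rule step, rule less) (simp only: less_basis_index_def)
  qed
next
  have "finite (range (Rep_basis_index :: 'a basis_index \<Rightarrow> 'a))"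
    unfolding range_Rep_basis_index by (rule finite_Basis)
  then show "finite (UNIV :: 'a basis_index set)"
    using inj_Rep_basis_index by (rule finite_imageD)
qed (auto simp: less_eq_basis_index_def less_basis_index_def)

end

section \<open>Lebesgue measure in Cartesian coordinates, and simplex volumes as
  determinants\<close>

lemma card_basis_index: "CARD('a::euclidean_space basis_index) = DIM('a)"
proof -
  have "card (range (Rep_basis_index :: 'a basis_index \<Rightarrow> 'a)) = CARD('a basis_index)"
    using inj_Rep_basis_index by (rule card_image)
  then show ?thesis unfolding range_Rep_basis_index by (rule sym)
qed

definition to_cart :: "'a::euclidean_space \<Rightarrow> real ^ 'a basis_index" where
  "to_cart x = (\<chi> i. x \<bullet> Rep_basis_index i)"

lemma to_cart_nth [simp]: "to_cart x $ i = x \<bullet> Rep_basis_index i"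
  by (simp add: to_cart_def)

lemma linear_to_cart: "linear to_cart"
  by (intro linearI) (auto simp: vec_eq_iff inner_simps)

lemma inj_to_cart: "inj to_cart"
proof (rule injI)
  fix x y :: 'a
  assume eq: "to_cart x = to_cart y"
  have "x \<bullet> b = y \<bullet> b" if b: "b \<in> Basis" for b
  proof -
    obtain i where "b = Rep_basis_index i" using b range_Rep_basis_index by blast
    then show ?thesis using eq by (metis to_cart_nth)
  qed
  then show "x = y" by (rule euclidean_eqI)
qed

lemma continuous_on_to_cart: "continuous_on S to_cart"
  using linear_continuous_on linear_to_cart linear_conv_bounded_linear by blast

lemma prod_Basis_cart:
  "(\<Prod>b\<in>Basis. f b) = (\<Prod>i\<in>UNIV. f (axis i (1::real)))" for f :: "real ^ 'n \<Rightarrow> real"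
proof -
  have "(Basis :: (real ^ 'n) set) = (\<lambda>i. axis i 1) ` UNIV"
    by (auto simp: Basis_vec_def)
  moreover have "inj (\<lambda>i. axis i 1 :: real ^ 'n)"
    by (auto simp: inj_def axis_eq_axis)
  ultimately show ?thesis using prod.reindex[of "\<lambda>i. axis i 1" UNIV f] by (simp add: o_def)
qed

text \<open>Lebesgue measure is determined by its values on boxes, and passing to coordinates turns
  boxes into boxes with the same side lengths.\<close>

lemma lborel_distr_to_cart: "lborel = distr lborel borel (to_cart :: 'a::euclidean_space \<Rightarrow> _)"
proof (rule lborel_eqI)
  fix l u :: "real ^ 'a basis_index"
  assume le: "\<And>b. b \<in> Basis \<Longrightarrow> l \<bullet> b \<le> u \<bullet> b"
  have meas: "(to_cart :: 'a \<Rightarrow> _) \<in> borel_measurable borel"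
    using continuous_on_to_cart by (rule borel_measurable_continuous_onI)
  \<comment> \<open>\<open>g\<close> inverts \<open>to_cart\<close>, so \<open>box l u\<close> pulls
    back to \<open>box (g l) (g u)\<close>.\<close>
  define g :: "real ^ 'a basis_index \<Rightarrow> 'a"
    where "g x = (\<Sum>b\<in>Basis. (x $ Abs_basis_index b) *\<^sub>R b)" for x
  have g: "g x \<bullet> b = x $ Abs_basis_index b" if "b \<in> Basis" for x b
    using that by (simp add: g_def)
  have "to_cart -` box l u = box (g l) (g u)"
  proof (intro set_eqI)
    fix x :: 'a
    have "x \<in> box (g l) (g u) \<longleftrightarrow> (\<forall>b\<in>range Rep_basis_index. g l \<bullet> b < x \<bullet> b \<and> x \<bullet> b < g u \<bullet> b)"
      by (simp add: mem_box range_Rep_basis_index)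
    also have "\<dots> \<longleftrightarrow> x \<in> to_cart -` box l u"
      by (simp add: mem_box_cart g Rep_basis_index Rep_basis_index_inverse)
    finally show "x \<in> to_cart -` box l u \<longleftrightarrow> x \<in> box (g l) (g u)" by simp
  qed
  then have "emeasure (distr lborel borel to_cart) (box l u) = emeasure lborel (box (g l) (g u))"
    by (subst emeasure_distr) (auto simp: meas)
  also have "\<dots> = (\<Prod>b\<in>Basis. (g u - g l) \<bullet> b)"
  proof (rule emeasure_lborel_box)
    fix b :: 'a assume b: "b \<in> Basis"
    show "g l \<bullet> b \<le> g u \<bullet> b"
      using le[of "axis (Abs_basis_index b) 1"] b
      by (auto simp: g inner_axis Basis_vec_def)
  qed
  also have "(\<Prod>b\<in>Basis. (g u - g l) \<bullet> b) = (\<Prod>i\<in>UNIV. (g u - g l) \<bullet> Rep_basis_index i)"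
    using prod.reindex[OF inj_Rep_basis_index, of "\<lambda>b. (g u - g l) \<bullet> b"]
    by (simp add: range_Rep_basis_index o_def)
  also have "\<dots> = (\<Prod>b\<in>Basis. (u - l) \<bullet> b)"
    by (simp add: prod_Basis_cart inner_diff_left g Rep_basis_index Rep_basis_index_inverse
        inner_axis)
  finally show "emeasure (distr lborel borel to_cart) (box l u) = (\<Prod>b\<in>Basis. (u - l) \<bullet> b)" .
qed simp

lemma measure_to_cart_image:
  assumes "compact S"
  shows "measure lebesgue (to_cart ` S) = measure lebesgue S"
proof -
  have c: "compact (to_cart ` S)"
    using assms continuous_on_to_cart by (rule compact_continuous_image[rotated])
  have "measure lebesgue (to_cart ` S) = measure lborel (to_cart ` S)"
    using c by (simp add: borel_compact)
  also have "\<dots> = measure (distr lborel borel to_cart) (to_cart ` S)"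
    by (subst lborel_distr_to_cart) simp
  also have "\<dots> = measure lborel (to_cart -` (to_cart ` S))"
    using c continuous_on_to_cart
    by (subst measure_distr) (auto intro: borel_compact borel_measurable_continuous_onI)
  also have "to_cart -` (to_cart ` S) = S"
    by (simp add: inj_to_cart inj_vimage_image_eq)
  also have "measure lborel S = measure lebesgue S"
    using assms by (simp add: borel_compact)
  finally show ?thesis .
qed

text \<open>The edge vectors from \<open>x\<close> are the columns of a matrix that carries the
  standard simplex onto a translate of this one. The volume of the standard simplex stays a symbolic
  factor, because only ratios of volumes matter later.\<close>

lemma measure_simplex_cart:
  fixes x :: "real ^ 'n::{finite, wellorder}" and f :: "'n::_ \<Rightarrow> real ^ ('n::_)"
  shows "measure lebesgue (convex hull (insert x (range f))) =
    \<bar>det (\<chi> i j. f j $ i - x $ i)\<bar> * measure lebesgue (convex hull (insert 0 Basis) :: (real ^ ('n::_)) set)"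
proof -
  define M :: "real ^ ('n::_) ^ ('n::_)" where "M = (\<chi> i j. f j $ i - x $ i)"
  have M: "M *v axis j 1 = f j - x" for j
    by (simp add: M_def matrix_vector_mult_basis column_def vec_eq_iff)
  have lin: "linear ((*v) M)" by simp
  have B: "(Basis :: (real ^ ('n::_)) set) = range (\<lambda>i. axis i 1)"
    by (auto simp: Basis_vec_def)
  have "convex hull (insert x (range f)) = convex hull ((+) x ` (insert 0 ((*v) M ` Basis)))"
    by (rule arg_cong[of _ _ "\<lambda>S. convex hull S"]) (auto simp: B M image_image)
  also have "\<dots> = convex hull ((+) x ` (*v) M ` insert 0 Basis)"
    by simp
  also have "\<dots> = (+) x ` (*v) M ` (convex hull (insert 0 Basis))"
    by (simp only: convex_hull_translation convex_hull_linear_image[OF lin])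
  finally have "measure lebesgue (convex hull (insert x (range f)))
      = measure lebesgue ((*v) M ` (convex hull (insert 0 Basis)))"
    by (simp add: measure_translation)
  also have "\<dots> = \<bar>det M\<bar> * measure lebesgue (convex hull (insert 0 Basis) :: (real ^ ('n::_)) set)"
    using measure_linear_image[OF lin, of "convex hull (insert 0 Basis)"]
    by (simp add: lmeasurable_compact finite_imp_compact_convex_hull)
  finally show ?thesis by (simp add: M_def)
qed

text \<open>Cramer's rule: seen from a vertex \<open>x\<close> other than \<open>c\<close>, the new
  vertex is the matrix of edge vectors applied to the weights \<open>u\<close>, so exchanging the
  column of \<open>c\<close> multiplies the determinant by \<open>u c\<close>.\<close>

lemma measure_simplex_replace_vertex:
  fixes C :: "'a::euclidean_space set"
  assumes C: "finite C" "card C = Suc DIM('a)" and c: "c \<in> C"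
    and u: "sum u C = 1"
  shows "measure lebesgue (convex hull (insert (\<Sum>e\<in>C. u e *\<^sub>R e) (C - {c}))) =
    \<bar>u c\<bar> * measure lebesgue (convex hull C)"
proof -
  define v where "v = (\<Sum>e\<in>C. u e *\<^sub>R e)"
  have "card (C - {c}) = DIM('a)" using C c by simp
  then have "C - {c} \<noteq> {}" by (metis DIM_positive card.empty less_irrefl)
  then obtain x where x: "x \<in> C" "x \<noteq> c" by blast
  have "card (C - {x}) = CARD('a basis_index)" using C x by (simp add: card_basis_index)
  then obtain f :: "'a basis_index \<Rightarrow> 'a" where f: "bij_betw f UNIV (C - {x})"
    using C by (metis bij_betw_iff_card finite_Diff finite_UNIV finite)
  obtain k where k: "f k = c" using f x c by (metis DiffI bij_betw_iff_bijections singletonD)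
  have inj: "inj f" and rng: "range f = C - {x}" using f by (auto simp: bij_betw_def)
  have hull: "measure lebesgue (convex hull (insert x (range g))) =
      \<bar>det (\<chi> i j. to_cart (g j) $ i - to_cart x $ i)\<bar> *
      measure lebesgue (convex hull (insert 0 Basis) :: (real ^ 'a basis_index) set)"
    for g :: "'a basis_index \<Rightarrow> 'a"
  proof -
    have "to_cart ` (convex hull (insert x (range g)))
        = convex hull (insert (to_cart x) (range (\<lambda>i. to_cart (g i))))"
      by (simp add: convex_hull_linear_image[OF linear_to_cart] image_image)
    moreover have "compact (convex hull (insert x (range g)))"
      by (intro finite_imp_compact_convex_hull) auto
    ultimately show ?thesis
      by (metis measure_to_cart_image measure_simplex_cart[of "to_cart x" "\<lambda>i. to_cart (g i)"])
  qed
  define M :: "real ^ 'a basis_index ^ 'a basis_index"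
    where "M = (\<chi> i j. to_cart (f j) $ i - to_cart x $ i)"
  have M_nth: "M $ i $ j = f j \<bullet> Rep_basis_index i - x \<bullet> Rep_basis_index i" for i j
    by (simp add: M_def)
  have sumC: "(\<Sum>e\<in>C. u e *\<^sub>R (e - x)) = (\<Sum>j\<in>UNIV. u (f j) *\<^sub>R (f j - x))"
  proof -
    have "(\<Sum>e\<in>C. u e *\<^sub>R (e - x)) = (\<Sum>e\<in>C - {x}. u e *\<^sub>R (e - x))"
      using C x by (simp add: sum.remove)
    then show ?thesis
      using sum.reindex[OF inj, of "\<lambda>e. u e *\<^sub>R (e - x)"] by (simp add: rng o_def)
  qed
  have "v - x = (\<Sum>e\<in>C. u e *\<^sub>R (e - x))"
    using u by (simp add: v_def scaleR_diff_right sum_subtractf flip: scaleR_left.sum)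
  then have "to_cart v - to_cart x = M *v (\<chi> j. u (f j))"
    unfolding sumC
    by (simp add: vec_eq_iff M_def matrix_vector_mult_def inner_sum_left mult.commute
        flip: inner_diff_left)
  then have comp: "to_cart v $ i - to_cart x $ i = (M *v (\<chi> j. u (f j))) $ i" for i
    by (metis vector_minus_component)
  have "det (\<chi> i j. to_cart ((f(k := v)) j) $ i - to_cart x $ i)
      = det (\<chi> i j. if j = k then (M *v (\<chi> j. u (f j))) $ i else M $ i $ j)"
    by (intro arg_cong[of _ _ det]) (auto simp: vec_eq_iff M_nth comp[unfolded to_cart_nth])
  also have "\<dots> = u c * det M" by (simp add: cramer_lemma k)
  finally have d: "det (\<chi> i j. to_cart ((f(k := v)) j) $ i - to_cart x $ i) = u c * det M" .
  have "range (f(k := v)) = insert v (range f - {c})"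
    using inj k by (auto simp: inj_def fun_upd_def image_iff)
  then have "insert x (range (f(k := v))) = insert v (C - {c})" using rng x by auto
  moreover have "insert x (range f) = C" using rng x by auto
  ultimately show ?thesis
    using hull[of "f(k := v)"] hull[of f] d by (simp add: M_def v_def abs_mult)
qed

section \<open>Barycentric coordinates\<close>

locale full_simplex =
  fixes C :: "'a::euclidean_space set"
  assumes indep: "\<not> affine_dependent C"
    and card_vertices: "card C = Suc DIM('a)"
begin

lemma finite_vertices [simp]: "finite C"
  using card_vertices card.infinite by fastforce

lemma affine_hull_vertices: "affine hull C = UNIV"
proof -
  have "aff_dim C = int DIM('a)"
    using aff_dim_affine_independent[OF indep] card_vertices by simp
  then show ?thesis by (simp add: aff_dim_eq_full)
qed

text \<open>The weights are chosen jointly: the choice depends on \<open>x\<close> but not on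
  \<open>e\<close>. Only the values at \<open>e\<close> in \<open>C\<close> are determined.\<close>

definition bary :: "'a \<Rightarrow> 'a \<Rightarrow> real" where
  "bary e x = (SOME u. sum u C = 1 \<and> (\<Sum>v\<in>C. u v *\<^sub>R v) = x) e"

lemma sum_bary [simp]: "(\<Sum>e\<in>C. bary e x) = 1"
  and sum_bary_scaleR [simp]: "(\<Sum>e\<in>C. bary e x *\<^sub>R e) = x"
proof -
  have "\<exists>u. sum u C = 1 \<and> (\<Sum>v\<in>C. u v *\<^sub>R v) = x"
    using affine_hull_finite[OF finite_vertices] affine_hull_vertices by auto
  from someI_ex[OF this] show "(\<Sum>e\<in>C. bary e x) = 1" "(\<Sum>e\<in>C. bary e x *\<^sub>R e) = x"
    by (simp_all add: bary_def)
qed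

text \<open>The difference of two weight functions for one point has sum 0 and linear combination 0,
  so affine independence makes it vanish on \<open>C\<close>.\<close>

lemma bary_eqI:
  assumes "sum u C = 1" "(\<Sum>v\<in>C. u v *\<^sub>R v) = x" "e \<in> C"
  shows "bary e x = u e"
proof (rule ccontr)
  assume "bary e x \<noteq> u e"
  then have "\<exists>v\<in>C. bary v x - u v \<noteq> 0" using assms(3) by auto
  moreover have "(\<Sum>v\<in>C. bary v x - u v) = 0" using assms by (simp add: sum_subtractf)
  moreover have "(\<Sum>v\<in>C. (bary v x - u v) *\<^sub>R v) = 0"
    using assms by (simp add: scaleR_diff_left sum_subtractf)
  ultimately have "affine_dependent C"
    using affine_dependent_explicit_finite[OF finite_vertices] by blast
  then show False using indep by simp
qed

text \<open>The weights \<open>b\<close> sum to \<open>1 - r\<close>, so adding \<open>r\<close>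
  times the coordinates of \<open>x\<close> gives total weight 1. Regions cut out by coordinate
  inequalities are rescaled to a fixed simplex in this way.\<close>

lemma bary_homothety:
  assumes "e \<in> C" "sum b C = 1 - r"
  shows "bary e ((\<Sum>v\<in>C. b v *\<^sub>R v) + r *\<^sub>R x) = b e + r * bary e x"
proof (rule bary_eqI)
  show "(\<Sum>v\<in>C. b v + r * bary v x) = 1"
    using assms by (simp add: sum.distrib flip: sum_distrib_left)
  have "(\<Sum>v\<in>C. (r * bary v x) *\<^sub>R v) = r *\<^sub>R x"
    using sum_bary_scaleR[of x] by (metis (no_types, lifting) scaleR_scaleR scaleR_sum_right sum.cong)
  then show "(\<Sum>v\<in>C. (b v + r * bary v x) *\<^sub>R v) = (\<Sum>v\<in>C. b v *\<^sub>R v) + r *\<^sub>R x"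
    by (simp add: scaleR_add_left sum.distrib)
qed (use assms in simp)

lemma bary_vertex: "e \<in> C \<Longrightarrow> v \<in> C \<Longrightarrow> bary e v = (if e = v then 1 else 0)"
  by (rule bary_eqI) (auto simp: if_distrib[of "\<lambda>r. r *\<^sub>R _"] cong: if_cong)

lemma bary_add_diff:
  assumes "e \<in> C"
  shows "bary e (x + y - z) = bary e x + bary e y - bary e z"
  using assms
  by (intro bary_eqI) (simp_all add: sum.distrib sum_subtractf scaleR_add_left scaleR_diff_left)

lemma linear_bary:
  assumes "e \<in> C"
  shows "linear (\<lambda>x. bary e x - bary e 0)"
proof (rule linearI)
  fix x y and r :: real
  show "bary e (x + y) - bary e 0 = bary e x - bary e 0 + (bary e y - bary e 0)"
    using bary_add_diff[OF assms, of x y 0] by simp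
  have "bary e (r *\<^sub>R x + (1 - r) *\<^sub>R 0) = r * bary e x + (1 - r) * bary e 0"
  proof (rule bary_eqI[OF _ _ assms])
    show "(\<Sum>v\<in>C. r * bary v x + (1 - r) * bary v 0) = 1"
      by (simp add: sum.distrib flip: sum_distrib_left)
    show "(\<Sum>v\<in>C. (r * bary v x + (1 - r) * bary v 0) *\<^sub>R v) = r *\<^sub>R x + (1 - r) *\<^sub>R 0"
      using sum_bary_scaleR[of x] sum_bary_scaleR[of 0]
      by (simp add: scaleR_add_left sum.distrib flip: scaleR_scaleR scaleR_sum_right)
  qed
  then show "bary e (r *\<^sub>R x) - bary e 0 = r *\<^sub>R (bary e x - bary e 0)"
    by (simp add: algebra_simps)
qed

lemma continuous_on_bary:
  assumes "e \<in> C"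
  shows "continuous_on S (bary e)"
proof -
  have "continuous_on S (\<lambda>x. (bary e x - bary e 0) + bary e 0)"
    using linear_bary[OF assms]
    by (intro continuous_on_add continuous_on_const linear_continuous_on)
       (simp add: linear_conv_bounded_linear)
  then show ?thesis by simp
qed

text \<open>The linear part of \<open>bary c\<close> is the inner product with \<open>w\<close>, and
  \<open>w\<close> is nonzero because \<open>bary c\<close> is 1 at \<open>c\<close> and 0 at
  another vertex. So the level set is a hyperplane.\<close>

lemma negligible_bary_level:
  assumes "c \<in> C"
  shows "negligible {x. bary c x = m}"
proof -
  define f where "f x = bary c x - bary c 0" for x
  define w where "w = (\<Sum>b\<in>Basis. f b *\<^sub>R b)"
  have f: "f x = w \<bullet> x" for x
    using linear_bary[OF assms, folded f_def] unfolding w_def inner_sum_left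
    by (subst (1) euclidean_representation[of x, symmetric], subst linear_sum)
       (auto simp: linear_cmul inner_commute mult.commute)
  have "card (C - {c}) = DIM('a)" using assms card_vertices by simp
  then have "C - {c} \<noteq> {}" by (metis DIM_positive card.empty less_irrefl)
  then obtain d where d: "d \<in> C" "d \<noteq> c" by blast
  have "w \<noteq> 0"
    using f[of c] f[of d] bary_vertex[OF assms assms] bary_vertex[OF assms d(1)] d by (auto simp: f_def)
  moreover have "{x. bary c x = m} = {x. w \<bullet> x = m - bary c 0}"
    by (auto simp: f_def simp flip: f)
  ultimately show ?thesis using negligible_hyperplane by metis
qed

lemma convex_hull_vertices: "convex hull C = {x. \<forall>e\<in>C. 0 \<le> bary e x}"
proof (intro set_eqI iffI)
  fix x assume "x \<in> convex hull C"
  then obtain u where u: "\<forall>e\<in>C. 0 \<le> u e" "sum u C = 1" "(\<Sum>e\<in>C. u e *\<^sub>R e) = x"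
    by (auto simp: convex_hull_finite)
  then show "x \<in> {x. \<forall>e\<in>C. 0 \<le> bary e x}" using bary_eqI by fastforce
next
  fix x assume "x \<in> {x. \<forall>e\<in>C. 0 \<le> bary e x}"
  then show "x \<in> convex hull C"
    unfolding convex_hull_finite[OF finite_vertices]
    by (auto intro!: exI[of _ "\<lambda>e. bary e x"])
qed

section \<open>Volumes of homothets of the simplex and of its version with a reflected
  vertex\<close>

lemma homothetic_preimage:
  assumes r: "r > 0" and b: "sum b C = 1 - r"
    and iff: "\<And>x. P ((\<Sum>v\<in>C. b v *\<^sub>R v) + r *\<^sub>R x) \<longleftrightarrow> x \<in> S"
    and S: "compact S"
  shows "{x. P x} \<in> lmeasurable"
    and "measure lebesgue {x. P x} = r ^ DIM('a) * measure lebesgue S"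
proof -
  define z where "z = (\<Sum>v\<in>C. b v *\<^sub>R v)"
  have eq: "{x. P x} = (\<lambda>x. r *\<^sub>R x + z) ` S"
  proof (intro set_eqI iffI)
    fix x assume "x \<in> {x. P x}"
    then have "P (z + r *\<^sub>R ((x - z) /\<^sub>R r))" using r by simp
    then have "(x - z) /\<^sub>R r \<in> S" by (simp only: iff[folded z_def])
    then show "x \<in> (\<lambda>x. r *\<^sub>R x + z) ` S" using r by (intro image_eqI[of _ _ "(x - z) /\<^sub>R r"]) auto
  qed (use iff[folded z_def] in \<open>auto simp: add.commute\<close>)
  show "measure lebesgue {x. P x} = r ^ DIM('a) * measure lebesgue S"
    using measure_lebesgue_affine[of r z S] r by (simp add: eq)
  have "compact ((\<lambda>x. r *\<^sub>R x + z) ` S)"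
    by (intro compact_continuous_image S continuous_intros)
  then show "{x. P x} \<in> lmeasurable" by (simp add: eq lmeasurable_compact)
qed

lemma
  assumes "sum a C < 1"
  shows lmeasurable_homothet: "{x. \<forall>e\<in>C. a e \<le> bary e x} \<in> lmeasurable" (is ?A)
    and measure_homothet: "measure lebesgue {x. \<forall>e\<in>C. a e \<le> bary e x} =
      (1 - sum a C) ^ DIM('a) * measure lebesgue (convex hull C)" (is ?B)
proof -
  have "(\<forall>e\<in>C. a e \<le> bary e ((\<Sum>v\<in>C. a v *\<^sub>R v) + (1 - sum a C) *\<^sub>R x)) \<longleftrightarrow> x \<in> convex hull C" for x
    using assms by (simp add: convex_hull_vertices bary_homothety zero_le_mult_iff)
  note homothetic_preimage[OF _ _ this]
  then show ?A ?B using assms by (simp_all add: finite_imp_compact_convex_hull)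
qed

text \<open>Giving \<open>v\<close> the weight \<open>s\<close> contributes \<open>- s / k\<close>
  to the coordinate at \<open>c\<close> and \<open>s / k\<close> to each other one, where
  \<open>k\<close> is the dimension minus 1. Adding the coordinate at \<open>c\<close> to another
  coordinate therefore recovers the weight of that other vertex.\<close>

lemma convex_hull_reflected_vertex:
  assumes n: "DIM('a) \<ge> 2" and c: "c \<in> C"
  defines "v \<equiv> (\<Sum>e\<in>C. ((if e = c then - 1 else 1) / (real DIM('a) - 1)) *\<^sub>R e)"
  shows "convex hull (insert v (C - {c})) =
    {x. bary c x \<le> 0 \<and> (\<forall>e\<in>C - {c}. 0 \<le> bary e x + bary c x)}"
proof -
  define k where "k = real DIM('a) - 1"
  have k: "k > 0" using n by (simp add: k_def)
  have card: "real (card (C - {c})) = k + 1" using c card_vertices by (simp add: k_def)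
  have rm: "sum f C = f c + sum f (C - {c})" for f :: "'a \<Rightarrow> 'b::comm_monoid_add"
    using c by (simp add: sum.remove)
  have v: "v = (1 / k) *\<^sub>R (\<Sum>(C - {c})) - (1 / k) *\<^sub>R c"
    unfolding v_def k_def[symmetric] rm by (simp add: scaleR_sum_right)
  have combination: "s *\<^sub>R v + (\<Sum>e\<in>C - {c}. w e *\<^sub>R e)
      = (\<Sum>e\<in>C. (if e = c then - s / k else w e + s / k) *\<^sub>R e)" for s w
    unfolding v rm by (simp add: scaleR_diff_right scaleR_add_left sum.distrib scaleR_sum_right)
  have weight: "(\<Sum>e\<in>C. if e = c then - s / k else w e + s / k) = s + sum w (C - {c})" for s w
  proof -
    have "(\<Sum>e\<in>C - {c}. if e = c then - s / k else w e + s / k) = (\<Sum>e\<in>C - {c}. w e + s / k)"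
      by (intro sum.cong) auto
    also have "\<dots> = sum w (C - {c}) + (k + 1) * (s / k)"
      unfolding sum.distrib sum_constant card ..
    finally show ?thesis unfolding rm using k by (simp add: field_simps)
  qed
  \<comment> \<open>The case \<open>s = 1\<close>, \<open>w = 0\<close> of \<open>weight\<close> and
    \<open>combination\<close>; the form \<open>0 + 1 / k\<close> matches them. A nonzero coordinate
    at \<open>c\<close> tells \<open>v\<close> apart from the vertices in
    \<open>C - {c}\<close>.\<close>
  have "bary c v = - 1 / k"
    using k weight[of 1 "\<lambda>_. 0"] combination[of 1 "\<lambda>_. 0"] c
    by (intro bary_eqI[THEN trans, of "\<lambda>e. if e = c then - 1 / k else 0 + 1 / k"]) auto
  then have notin: "v \<notin> C - {c}" using bary_vertex[OF c, of v] divide_pos_pos[OF zero_less_one k]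
    by (auto split: if_splits)
  show ?thesis
  proof (intro set_eqI iffI)
    fix x assume "x \<in> convex hull (insert v (C - {c}))"
    then obtain w where w: "\<And>e. e \<in> insert v (C - {c}) \<Longrightarrow> 0 \<le> w e"
      "sum w (insert v (C - {c})) = 1" "(\<Sum>e\<in>insert v (C - {c}). w e *\<^sub>R e) = x"
      by (auto simp: convex_hull_finite)
    have "bary e x = (if e = c then - w v / k else w e + w v / k)" if "e \<in> C" for e
      using w notin that by (intro bary_eqI) (simp_all add: weight flip: combination)
    moreover have "0 \<le> w v / k" using w(1)[of v] k by simp
    ultimately show "x \<in> {x. bary c x \<le> 0 \<and> (\<forall>e\<in>C - {c}. 0 \<le> bary e x + bary c x)}"
      using w(1) c by auto
  next
    fix x assume x: "x \<in> {x. bary c x \<le> 0 \<and> (\<forall>e\<in>C - {c}. 0 \<le> bary e x + bary c x)}"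
    \<comment> \<open>The coordinate at \<open>c\<close> must equal \<open>- w v / k\<close>, which
      forces \<open>w v\<close>; the other weights follow.\<close>
    define w where "w e = (if e = v then - k * bary c x else bary e x + bary c x)" for e
    have w_off: "w e = bary e x + bary c x" if "e \<in> C - {c}" for e
      using that notin by (auto simp: w_def)
    have wv: "w v / k = - bary c x" using k by (simp add: w_def)
    have coord: "(if e = c then - w v / k else w e + w v / k) = bary e x" if "e \<in> C" for e
      using wv w_off[of e] that by auto
    have "\<forall>e\<in>insert v (C - {c}). 0 \<le> w e"
      using x k w_off by (auto simp: w_def mult_nonneg_nonpos)
    moreover have "sum w (insert v (C - {c})) = 1"
      using notin by (simp add: coord flip: weight)
    moreover have "(\<Sum>e\<in>insert v (C - {c}). w e *\<^sub>R e) = x"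
      using notin by (simp add: combination coord)
    ultimately show "x \<in> convex hull (insert v (C - {c}))"
      unfolding convex_hull_finite[OF finite.insertI[OF finite_Diff[OF finite_vertices]]] by blast
  qed
qed

text \<open>The homothety with weights \<open>h\<close> at \<open>c\<close> and
  \<open>a e - h\<close> elsewhere, which sum to \<open>1 - r\<close>, turns the inequalities into
  those of the simplex with \<open>c\<close> reflected. The weight of the new vertex at
  \<open>c\<close> has absolute value \<open>1 / (n - 1)\<close> in dimension \<open>n\<close>;
  hence the divisor.\<close>

lemma
  assumes n: "DIM('a) \<ge> 2" and c: "c \<in> C"
    and r: "r = 1 + (real DIM('a) - 1) * h - sum a (C - {c})" "r > 0"
  shows lmeasurable_reflected: "{x. bary c x \<le> h \<and> (\<forall>e\<in>C - {c}. a e \<le> bary e x + bary c x)} \<in> lmeasurable" (is ?A)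
    and measure_reflected: "measure lebesgue {x. bary c x \<le> h \<and> (\<forall>e\<in>C - {c}. a e \<le> bary e x + bary c x)} =
      r ^ DIM('a) * (measure lebesgue (convex hull C) / (real DIM('a) - 1))" (is ?B)
proof -
  define b where "b e = (if e = c then h else a e - h)" for e
  define v where "v = (\<Sum>e\<in>C. ((if e = c then - 1 else 1) / (real DIM('a) - 1)) *\<^sub>R e)"
  define S where "S = convex hull (insert v (C - {c}))"
  have card: "card (C - {c}) = DIM('a)" using c card_vertices by simp
  have b: "sum b C = 1 - r"
    using c card by (simp add: b_def sum.remove sum_subtractf r algebra_simps)
  have "bary c ((\<Sum>v\<in>C. b v *\<^sub>R v) + r *\<^sub>R x) \<le> h \<and>
      (\<forall>e\<in>C - {c}. a e \<le> bary e ((\<Sum>v\<in>C. b v *\<^sub>R v) + r *\<^sub>R x) + bary c ((\<Sum>v\<in>C. b v *\<^sub>R v) + r *\<^sub>R x))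
      \<longleftrightarrow> x \<in> S" for x
  proof -
    have "a e \<le> b e + r * bary e x + (b c + r * bary c x) \<longleftrightarrow> 0 \<le> bary e x + bary c x"
      if "e \<in> C - {c}" for e
      using that r(2) zero_le_mult_iff[of r "bary e x + bary c x"] by (auto simp: b_def distrib_left)
    moreover have "b c + r * bary c x \<le> h \<longleftrightarrow> bary c x \<le> 0"
      using r(2) mult_le_0_iff[of r "bary c x"] by (auto simp: b_def)
    ultimately show ?thesis
      unfolding S_def v_def convex_hull_reflected_vertex[OF n c] using c
      by (simp add: bary_homothety b)
  qed
  note preimage = homothetic_preimage[OF r(2) b this]
  have "compact S" unfolding S_def by (intro finite_imp_compact_convex_hull) simp
  moreover have "(\<Sum>e\<in>C. (if e = c then - 1 else 1) / (real DIM('a) - 1)) = 1"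
    using c card n by (simp add: sum.remove flip: sum_divide_distrib)
  then have "measure lebesgue S = measure lebesgue (convex hull C) / (real DIM('a) - 1)"
    using measure_simplex_replace_vertex[OF finite_vertices card_vertices c, of "\<lambda>e. (if e = c then - 1 else 1) / (real DIM('a) - 1)"] n
    by (simp add: S_def v_def)
  ultimately show ?A ?B using preimage by simp_all
qed

end

section \<open>The volume bound\<close>

text \<open>Convexity of the power at the midpoint of 1 and \<open>q\<close>. In the induction the
  product of two means falls short of the mean of the products by
  \<open>(1 - q) * (1 - q ^ n) / 4\<close>.\<close>

lemma midpoint_power_le:
  assumes "0 \<le> q" "q \<le> (1::real)"
  shows "((1 + q) / 2) ^ n \<le> (1 + q ^ n) / 2"
proof (induction n)
  case (Suc n)
  have "((1 + q) / 2) ^ Suc n \<le> (1 + q) / 2 * ((1 + q ^ n) / 2)"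
    using Suc assms by (simp add: mult_left_mono)
  also have "\<dots> = (1 + q ^ Suc n) / 2 - (1 - q) * (1 - q ^ n) / 4"
    by (simp add: field_simps)
  also have "\<dots> \<le> (1 + q ^ Suc n) / 2"
  proof -
    have "0 \<le> (1 - q) * (1 - q ^ n)"
      using assms by (intro mult_nonneg_nonneg) (simp_all add: power_le_one)
    then show ?thesis by linarith
  qed
  finally show ?case .
qed simp

text \<open>With \<open>r = (1 + q) / 2\<close> the left side is
  \<open>(2 * k * r ^ n - (k + 1) * q ^ n) / (k - 1)\<close>, and midpoint convexity bounds its
  numerator by \<open>k - q ^ n\<close>.\<close>

lemma frustum_bound:
  fixes k :: real
  assumes "0 \<le> q" "q \<le> 1" "k > 1"
  shows "((1 + q) / 2) ^ n + (k + 1) * ((((1 + q) / 2) ^ n - q ^ n) / (k - 1)) \<le> k / (k - 1)"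
proof -
  have "((1 + q) / 2) ^ n + (k + 1) * ((((1 + q) / 2) ^ n - q ^ n) / (k - 1))
      = (2 * k * ((1 + q) / 2) ^ n - (k + 1) * q ^ n) / (k - 1)"
    using assms by (simp add: field_simps)
  also have "\<dots> \<le> (2 * k * ((1 + q ^ n) / 2) - (k + 1) * q ^ n) / (k - 1)"
    using assms midpoint_power_le[of q n] by (intro divide_right_mono diff_mono mult_left_mono) auto
  also have "\<dots> \<le> k / (k - 1)"
    using assms by (intro divide_right_mono) (auto simp: algebra_simps)
  finally show ?thesis .
qed

context full_simplex
begin

section \<open>From projections along edges to coordinate inequalities, and from these to
  volume\<close>

lemma sum_remove_two:
  fixes f :: "'a \<Rightarrow> real"
  assumes "c \<in> C" "d \<in> C" "c \<noteq> d"
  shows "sum f C = f c + f d + sum f (C - {c, d})"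
proof -
  have "sum f C = f c + sum f (C - {c})" using assms by (simp add: sum.remove)
  also have "sum f (C - {c}) = f d + sum f (C - {c} - {d})" using assms by (intro sum.remove) auto
  also have "C - {c} - {d} = C - {c, d}" by auto
  finally show ?thesis by simp
qed

text \<open>Moving along \<open>c - d\<close> changes neither the other coordinates nor the sum of
  those at \<open>c\<close> and \<open>d\<close>. After the translation by \<open>w\<close> these
  are values at a point of the simplex, hence nonnegative. The shifts \<open>l\<close> caused by
  \<open>w\<close> sum to 0, so they cancel when the bound for \<open>x\<close> is added to those
  for the points \<open>p e\<close>.\<close>

lemma bary_pair_lower_bound:
  assumes c: "c \<in> C" "d \<in> C" "c \<noteq> d"
    and proj: "\<forall>u. norm u = 1 \<longrightarrow> (\<exists>w. (\<lambda>x. x + w) ` proj_perp u K \<subseteq> proj_perp u (convex hull C))"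
    and p: "\<And>e. e \<in> C \<Longrightarrow> p e \<in> K" and x: "x \<in> K"
  shows "bary c x + bary d x + (\<Sum>e\<in>C - {c, d}. bary e (p e)) \<ge> 0"
proof -
  define u where "u = (c - d) /\<^sub>R norm (c - d)"
  have "norm u = 1" using c by (simp add: u_def)
  then obtain w where w: "(\<lambda>x. x + w) ` proj_perp u K \<subseteq> proj_perp u (convex hull C)"
    using proj by blast
  define l where "l e = bary e w - bary e 0" for e
  have line: "\<exists>y s. (\<forall>e\<in>C. 0 \<le> bary e y) \<and> x = y + s *\<^sub>R c - s *\<^sub>R d - w" if "x \<in> K" for x
  proof -
    have "x - (x \<bullet> u) *\<^sub>R u + w \<in> proj_perp u (convex hull C)"
      using w that by (auto simp: proj_perp_def)
    then obtain y where y: "y \<in> convex hull C" "x - (x \<bullet> u) *\<^sub>R u + w = y - (y \<bullet> u) *\<^sub>R u"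
      by (auto simp: proj_perp_def)
    define s where "s = (x \<bullet> u - y \<bullet> u) / norm (c - d)"
    have "x = y + (x \<bullet> u - y \<bullet> u) *\<^sub>R u - w"
      using y(2) by (simp add: algebra_simps)
    also have "(x \<bullet> u - y \<bullet> u) *\<^sub>R u = s *\<^sub>R (c - d)"
      by (simp add: u_def s_def divide_inverse)
    finally have "x = y + s *\<^sub>R c - s *\<^sub>R d - w" by (simp add: scaleR_diff_right)
    then show ?thesis using y(1) by (auto simp: convex_hull_vertices)
  qed
  have coord: "bary e (y + s *\<^sub>R c - s *\<^sub>R d - w) = bary e y + s * (bary e c - bary e d) - l e"
    if e: "e \<in> C" for e y s
  proof -
    have lin: "bary e (s *\<^sub>R z) - bary e 0 = s * (bary e z - bary e 0)" for z
      using linear_cmul[OF linear_bary[OF e], of s z] by simp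
    \<comment> \<open>The inserted 0 gives the shape \<open>x + y - z\<close> of
      \<open>bary_add_diff\<close>.\<close>
    have "bary e (y + s *\<^sub>R c - s *\<^sub>R d + 0 - w) = bary e (y + s *\<^sub>R c - s *\<^sub>R d) - l e"
      unfolding bary_add_diff[OF e, of "y + s *\<^sub>R c - s *\<^sub>R d"] by (simp add: l_def)
    then show ?thesis
      using lin[of c] lin[of d] by (simp add: bary_add_diff[OF e, of y] algebra_simps)
  qed
  have single: "bary e x + l e \<ge> 0" if e: "e \<in> C - {c, d}" and "x \<in> K" for e x
  proof -
    obtain y s where y: "\<forall>e\<in>C. 0 \<le> bary e y" and x: "x = y + s *\<^sub>R c - s *\<^sub>R d - w"
      using line[OF \<open>x \<in> K\<close>] by blast
    have "bary e x = bary e y - l e"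
      unfolding x using e c by (subst coord) (auto simp: bary_vertex)
    then show ?thesis using y e by auto
  qed
  obtain y s where y: "\<forall>e\<in>C. 0 \<le> bary e y" and xy: "x = y + s *\<^sub>R c - s *\<^sub>R d - w"
    using line[OF x] by blast
  have "bary c x = bary c y + s - l c" "bary d x = bary d y - s - l d"
    unfolding xy using c by (subst coord; auto simp: bary_vertex)+
  then have pair: "bary c x + bary d x + l c + l d \<ge> 0"
    using y c by (smt (verit))
  have "0 \<le> (\<Sum>e\<in>C - {c, d}. bary e (p e) + l e)"
    using single p by (intro sum_nonneg) auto
  moreover have "l c + l d + sum l (C - {c, d}) = 0"
    unfolding sum_remove_two[OF c, symmetric] by (simp add: l_def sum_subtractf)
  ultimately show ?thesis using pair by (simp add: sum.distrib)
qed

lemma measure_le_of_bary_pair_bounds: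
  assumes n: "DIM('a) \<ge> 2" and K: "compact K"
    and p: "\<And>e. e \<in> C \<Longrightarrow> p e \<in> K" "\<And>e x. e \<in> C \<Longrightarrow> x \<in> K \<Longrightarrow> bary e (p e) \<le> bary e x"
    and pair: "\<And>c d x. c \<in> C \<Longrightarrow> d \<in> C \<Longrightarrow> c \<noteq> d \<Longrightarrow> x \<in> K \<Longrightarrow>
      bary c x + bary d x + (\<Sum>e\<in>C - {c, d}. bary e (p e)) \<ge> 0"
  shows "measure lebesgue K \<le> real DIM('a) / (real DIM('a) - 1) * measure lebesgue (convex hull C)"
proof -
  define V where "V = measure lebesgue (convex hull C)"
  define k where "k = real DIM('a)"
  have k: "k > 1" using n by (simp add: k_def)
  have V: "V \<ge> 0" by (simp add: V_def)
  define m where "m e = bary e (p e)" for e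
  define t where "t = - sum m C"
  have m: "m e \<le> bary e x" if "e \<in> C" "x \<in> K" for e x using p that by (simp add: m_def)
  have cardC: "real (card C) = k + 1" by (simp add: card_vertices k_def)
  \<comment> \<open>The minima at the remaining vertices sum to
    \<open>- t - m c - m d\<close>.\<close>
  have pair': "m c + m d + t \<le> bary c x + bary d x"
    if "c \<in> C" "d \<in> C" "c \<noteq> d" "x \<in> K" for c d x
    using pair[OF that] sum_remove_two[OF that(1-3), of m] by (simp add: t_def flip: m_def)
  have Kmeas: "K \<in> sets lebesgue" using K by (simp add: lmeasurable_compact fmeasurableD)
  show ?thesis
  proof (cases "t \<le> 0")
    case True
    \<comment> \<open>Spreading \<open>t\<close> evenly over the \<open>k + 1\<close> coordinates
      makes the lower bounds sum to 0, so they cut out a translate of the simplex;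
      \<open>t <= 0\<close> keeps them below the minima.\<close>
    define a where "a e = m e + t / (k + 1)" for e
    have suma: "sum a C = 0" using k unfolding a_def sum.distrib sum_constant cardC by (simp add: t_def)
    have am: "a e \<le> m e" for e using True k by (simp add: a_def divide_nonpos_pos)
    then have "K \<subseteq> {x. \<forall>e\<in>C. a e \<le> bary e x}" using order_trans[OF am m] by blast
    then have "measure lebesgue K \<le> measure lebesgue {x. \<forall>e\<in>C. a e \<le> bary e x}"
      using Kmeas lmeasurable_homothet[of a] suma by (intro measure_mono_fmeasurable) auto
    also have "\<dots> = V" using measure_homothet[of a] suma by (simp add: V_def)
    also have "\<dots> \<le> k / (k - 1) * V" using k V by (simp add: mult_left_le_one_le field_simps)
    finally show ?thesis by (simp add: k_def V_def)
  next
    case False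
    define q where "q = 1 - (k - 1) * t"
    define r where "r = (1 + q) / 2"
    have "C \<noteq> {}" using card_vertices by auto
    then obtain c0 where c0: "c0 \<in> C" by blast
    \<comment> \<open>At the minimizer \<open>p c0\<close> the pair bound becomes
      \<open>m e + t <= bary e (p c0)\<close>. Summing over the \<open>k\<close> vertices other than
      \<open>c0\<close> yields \<open>(k - 1) * t <= 1\<close>.\<close>
    have "sum m (C - {c0}) + k * t = (\<Sum>e\<in>C - {c0}. m e + t)"
      using c0 card_vertices by (simp add: sum.distrib k_def)
    also have "\<dots> \<le> (\<Sum>e\<in>C - {c0}. bary e (p c0))"
      using pair'[OF _ c0 _ p(1)[OF c0]] by (intro sum_mono) (force simp: m_def)
    also have "\<dots> = 1 - m c0"
      using c0 sum.remove[of C c0 "\<lambda>e. bary e (p c0)"] by (simp add: m_def)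
    also have "sum m (C - {c0}) = - t - m c0"
      using c0 by (simp add: t_def sum.remove)
    finally have q0: "0 \<le> q" by (simp add: q_def left_diff_distrib)
    have q1: "q \<le> 1" using False k by (simp add: q_def)
    have r: "r > 0" using q0 by (simp add: r_def)
    \<comment> \<open>\<open>D c h\<close> keeps the pair bounds that involve \<open>c\<close>. It
      is a homothet of the reflected simplex; by \<open>scale\<close>, the levels \<open>m c\<close>
      and \<open>m c + t / 2\<close> give the ratios \<open>q\<close> and \<open>r\<close>.\<close>
    define D where "D c h = {x. bary c x \<le> h \<and> (\<forall>e\<in>C - {c}. m e + m c + t \<le> bary e x + bary c x)}" for c h
    define A where "A = {x. \<forall>e\<in>C. m e + t / 2 \<le> bary e x}"
    define F where "F c = D c (m c + t / 2) - D c (m c)" for c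
    \<comment> \<open>\<open>F c\<close> omits its bottom facet, which \<open>K\<close> touches at
      \<open>p c\<close>; the null set \<open>N\<close> puts it back.\<close>
    define N where "N = (\<Union>c\<in>C. {x. bary c x = m c})"
    have scale: "1 + (k - 1) * h - (\<Sum>e\<in>C - {c}. m e + m c + t) = q + (k - 1) * (h - m c)"
      if "c \<in> C" for c h
    proof -
      have "(\<Sum>e\<in>C - {c}. m e + m c + t) = sum m (C - {c}) + k * (m c + t)"
        using that card_vertices by (simp add: sum.distrib k_def distrib_left)
      moreover have "sum m (C - {c}) = - t - m c"
        using that by (simp add: t_def sum.remove)
      ultimately show ?thesis by (simp add: q_def algebra_simps)
    qed
    have D_sets: "D c h \<in> sets lebesgue" if c: "c \<in> C" for c h
    proof -
      have "D c h = {x. bary c x \<le> h} \<inter> (\<Inter>e\<in>C - {c}. {x. m e + m c + t \<le> bary e x + bary c x})"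
        by (auto simp: D_def)
      also have "closed \<dots>"
        using c by (intro closed_Int closed_INT ballI closed_Collect_le continuous_intros continuous_on_bary) auto
      finally show ?thesis by (simp add: borel_closed)
    qed
    have D: "D c h \<in> lmeasurable" "measure lebesgue (D c h) = (q + (k - 1) * (h - m c)) ^ DIM('a) * (V / (k - 1))"
      if "c \<in> C" "q + (k - 1) * (h - m c) > 0" for c h
      unfolding D_def V_def k_def
      using lmeasurable_reflected[OF n that(1) refl, of h "\<lambda>e. m e + m c + t"]
        measure_reflected[OF n that(1) refl, of h "\<lambda>e. m e + m c + t"] scale[OF that(1), of h] that(2)
      by (simp_all add: k_def)
    have r': "q + (k - 1) * (m c + t / 2 - m c) = r" for c
      by (simp add: q_def r_def field_simps)
    have F: "F c \<in> lmeasurable" "measure lebesgue (F c) \<le> (r ^ DIM('a) - q ^ DIM('a)) * (V / (k - 1))"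
      if c: "c \<in> C" for c
    proof -
      note D1 = D[OF c, of "m c + t / 2", unfolded r', OF r]
      show "measure lebesgue (F c) \<le> (r ^ DIM('a) - q ^ DIM('a)) * (V / (k - 1))"
      proof (cases "q = 0")
        case True
        then have "measure lebesgue (F c) \<le> measure lebesgue (D c (m c + t / 2))"
          unfolding F_def using D1(1) D_sets[OF c]
          by (intro measure_mono_fmeasurable) (auto simp: fmeasurableD)
        then show ?thesis using True D1 n by (simp add: power_0_left)
      next
        case False
        then have "q + (k - 1) * (m c - m c) > 0" using q0 by simp
        note D0 = D[OF c this]
        have "D c (m c) \<subseteq> D c (m c + t / 2)" using \<open>\<not> t \<le> 0\<close> by (auto simp: D_def)
        then show ?thesis
          unfolding F_def using D0 D1 by (simp add: measurable_measure_Diff fmeasurableD left_diff_distrib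
            diff_divide_distrib)
      qed
      show "F c \<in> lmeasurable"
        unfolding F_def using D1(1) D_sets[OF c] by (rule fmeasurable_Diff)
    qed
    have "K \<subseteq> (A \<union> (\<Union>c\<in>C. F c)) \<union> N"
    proof
      fix x assume x: "x \<in> K"
      show "x \<in> (A \<union> (\<Union>c\<in>C. F c)) \<union> N"
      proof (rule ccontr)
        assume no: "x \<notin> (A \<union> (\<Union>c\<in>C. F c)) \<union> N"
        \<comment> \<open>Outside \<open>A\<close> some coordinate lies below
          \<open>m c + t / 2\<close>, and the pair bounds put \<open>x\<close> in the larger
          \<open>D\<close> set. Not being in \<open>F c\<close>, it is in the smaller one, hence at
          the minimal level.\<close>
        then obtain c where c: "c \<in> C" "bary c x < m c + t / 2" by (force simp: A_def)
        then have "x \<in> D c (m c + t / 2)"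
          using pair'[OF _ c(1) _ x] by (auto simp: D_def)
        then have "x \<in> D c (m c)" using no c by (auto simp: F_def)
        then have "bary c x = m c" using m[OF c(1) x] by (simp add: D_def)
        then show False using no c by (auto simp: N_def)
      qed
    qed
    moreover have A: "A \<in> lmeasurable" "measure lebesgue A = r ^ DIM('a) * V"
    proof -
      \<comment> \<open>The bounds sum to \<open>(k - 1) * t / 2\<close>, half of
        \<open>1 - q\<close>, so \<open>A\<close> has the same ratio as the larger \<open>D\<close>
        sets.\<close>
      have "1 - (\<Sum>e\<in>C. m e + t / 2) = r"
        unfolding sum.distrib sum_constant cardC using t_def by (simp add: r_def q_def field_simps)
      then show "A \<in> lmeasurable" "measure lebesgue A = r ^ DIM('a) * V"
        using r lmeasurable_homothet[of "\<lambda>e. m e + t / 2"] measure_homothet[of "\<lambda>e. m e + t / 2"]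
        by (simp_all add: A_def V_def)
    qed
    moreover have UF: "(\<Union>c\<in>C. F c) \<in> lmeasurable"
      using F by (intro fmeasurable.finite_UN) auto
    moreover have N: "negligible N"
      unfolding N_def using negligible_bary_level by (intro negligible_Union) auto
    ultimately have "measure lebesgue K \<le> measure lebesgue ((A \<union> (\<Union>c\<in>C. F c)) \<union> N)"
      using Kmeas by (intro measure_mono_fmeasurable) (auto simp: negligible_imp_measurable)
    also have "\<dots> \<le> measure lebesgue A + measure lebesgue (\<Union>c\<in>C. F c) + measure lebesgue N"
      using A UF N by (meson add_right_mono measure_Un_le fmeasurableD fmeasurable.Un negligible_imp_measurable order_trans)
    also have "\<dots> \<le> r ^ DIM('a) * V + (\<Sum>c\<in>C. (r ^ DIM('a) - q ^ DIM('a)) * (V / (k - 1)))"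
    proof -
      have "measure lebesgue (\<Union>c\<in>C. F c) \<le> (\<Sum>c\<in>C. measure lebesgue (F c))"
        using F by (intro measure_UNION_le) auto
      also have "\<dots> \<le> (\<Sum>c\<in>C. (r ^ DIM('a) - q ^ DIM('a)) * (V / (k - 1)))"
        using F by (intro sum_mono) auto
      finally show ?thesis using A N by (simp add: negligible_imp_measure0)
    qed
    also have "\<dots> = (r ^ DIM('a) + (k + 1) * ((r ^ DIM('a) - q ^ DIM('a)) / (k - 1))) * V"
      unfolding sum_constant cardC by (simp add: distrib_right)
    also have "\<dots> \<le> k / (k - 1) * V"
      using frustum_bound[OF q0 q1 k, of "DIM('a)"] V unfolding r_def by (rule mult_right_mono)
    finally show ?thesis by (simp add: k_def V_def)
  qed
qed

end

theorem theorem4p3: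
  fixes K T :: "'a::euclidean_space set"
  assumes "DIM('a) \<ge> 2"
    and "compact K" and "convex K"
    and "int DIM('a) simplex T"
    and "\<forall>u. norm u = 1 \<longrightarrow> (\<exists>w. (\<lambda>x. x + w) ` proj_perp u K \<subseteq> proj_perp u T)"
  shows "measure lebesgue K \<le> (real DIM('a) / (real DIM('a) - 1)) * measure lebesgue T"
proof (cases "K = {}")
  case True
  then show ?thesis using assms(1) by simp
next
  case False
  obtain C where C: "\<not> affine_dependent C" "int (card C) = int DIM('a) + 1" "T = convex hull C"
    using assms(4) unfolding simplex_def by blast
  interpret full_simplex C
    using C by unfold_locales auto
  \<comment> \<open>Each coordinate is continuous and attains its minimum on the nonempty compact
    set \<open>K\<close>.\<close>
  have "\<forall>e\<in>C. \<exists>x\<in>K. \<forall>y\<in>K. bary e x \<le> bary e y"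
    using continuous_attains_inf[OF assms(2) False continuous_on_bary] by blast
  then obtain p where p: "\<And>e. e \<in> C \<Longrightarrow> p e \<in> K"
    "\<And>e x. e \<in> C \<Longrightarrow> x \<in> K \<Longrightarrow> bary e (p e) \<le> bary e x"
    by metis
  show ?thesis
    unfolding C(3)
    by (rule measure_le_of_bary_pair_bounds[OF assms(1,2) p])
       (use bary_pair_lower_bound[OF _ _ _ assms(5)[unfolded C(3)] p(1)] in auto)
qed

end
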